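(* Every finite birack is a twist of the second kind of a biquandle. That is, if $X$ is a finite set and $\sigma:X\times X\to X\times X$ is a birack, then there exist a biquandle $\tau:X\times X\to X\times X$ on the same set $X$ and a linear automorphism $\psi:X\to X$ of $\tau$ such that $\sigma$ is one of the twisted maps ${}^\psi\tau=\tau\circ(\psi\times\mathrm{Id})$ or $\tau^\psi=\tau\circ(\mathrm{Id}\times\psi)$.
   Context: A birack on $X$ is a bijective map $\sigma:X\times X\to X\times X$, $\sigma(x,y)=(g_x(y),f_y(x))$, satisfying the braid equation $(\sigma\times \mathrm{Id})(\mathrm{Id}\times\sigma)(\sigma\times \mathrm{Id})=(\mathrm{Id}\times\sigma)(\sigma\times \mathrm{Id})(\mathrm{Id}\times\sigma)$, such that all $g_x:X\to X$ and all $f_y:X\to X$ are bijective. A biquandle is a birack $\sigma$ such that for every $x\in X$ there is a unique $y\in X$ with $\sigma(x,y)=(x,y)$. For a birack $\sigma$, put $x*y:=g_x(y)$, let $x\cdot(-)$ be the inverse bijection of $x*(-)$, and let $x\triangleleft y:=g_y(f_{g_x^{-1}(y)}(x))$ (the derived rack operation). A linear automorphism of $\sigma$ is a bijection $\phi:X\to X$ such that for all $x,y\in X$: $\phi(x\cdot y)=x\cdot\phi(y)$, $\phi(x)\cdot y=x\cdot y$, $\phi(x\triangleleft y)=\phi(x)\triangleleft y$, and $x\triangleleft\phi(y)=x\triangleleft y$. The twists of the second kind of $\sigma$ by a linear automorphism $\phi$ are ${}^\phi\sigma:=\sigma(\phi\times\mathrm{Id})$ and $\sigma^\phi:=\sigma(\mathrm{Id}\times\phi)$;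 these are again solutions of the braid equation. *)

theory Defs
  imports Main
begin

text \<open>
  The underlying set of a birack is an explicit carrier \<open>X\<close>, which may be empty. Maps on \<open>X\<close> and
  \<open>X \<times> X\<close> are total HOL functions of which only the values on the carrier are meaningful;
  accordingly, two such maps are considered equal when they agree on the carrier.
\<close>

definition g_map :: "('a \<times> 'a \<Rightarrow> 'a \<times> 'a) \<Rightarrow> 'a \<Rightarrow> 'a \<Rightarrow> 'a" where
  "g_map \<sigma> x y = fst (\<sigma> (x, y))"

definition f_map :: "('a \<times> 'a \<Rightarrow> 'a \<times> 'a) \<Rightarrow> 'a \<Rightarrow> 'a \<Rightarrow> 'a" where
  "f_map \<sigma> y x = snd (\<sigma> (x, y))"

text \<open>
  \<open>act12 \<sigma>\<close> and \<open>act23 \<sigma>\<close> are \<open>\<sigma> \<times> Id\<close> and \<open>Id \<times> \<sigma>\<close>, both read on \<open>X \<times> X \<times> X\<close>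
  with right-nested triples.
\<close>

definition act12 :: "('a \<times> 'a \<Rightarrow> 'a \<times> 'a) \<Rightarrow> 'a \<times> 'a \<times> 'a \<Rightarrow> 'a \<times> 'a \<times> 'a" where
  "act12 \<sigma> = (\<lambda>(x, y, z). (fst (\<sigma> (x, y)), snd (\<sigma> (x, y)), z))"

definition act23 :: "('a \<times> 'a \<Rightarrow> 'a \<times> 'a) \<Rightarrow> 'a \<times> 'a \<times> 'a \<Rightarrow> 'a \<times> 'a \<times> 'a" where
  "act23 \<sigma> = (\<lambda>(x, y, z). (x, \<sigma> (y, z)))"

definition braid_equation :: "'a set \<Rightarrow> ('a \<times> 'a \<Rightarrow> 'a \<times> 'a) \<Rightarrow> bool" where
  "braid_equation X \<sigma> \<longleftrightarrow>
     (\<forall>t \<in> X \<times> X \<times> X.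
        (act12 \<sigma> \<circ> act23 \<sigma> \<circ> act12 \<sigma>) t = (act23 \<sigma> \<circ> act12 \<sigma> \<circ> act23 \<sigma>) t)"

definition birack :: "'a set \<Rightarrow> ('a \<times> 'a \<Rightarrow> 'a \<times> 'a) \<Rightarrow> bool" where
  "birack X \<sigma> \<longleftrightarrow>
     bij_betw \<sigma> (X \<times> X) (X \<times> X) \<and>
     braid_equation X \<sigma> \<and>
     (\<forall>x \<in> X. bij_betw (g_map \<sigma> x) X X) \<and>
     (\<forall>y \<in> X. bij_betw (f_map \<sigma> y) X X)"

definition biquandle :: "'a set \<Rightarrow> ('a \<times> 'a \<Rightarrow> 'a \<times> 'a) \<Rightarrow> bool" where
  "biquandle X \<sigma> \<longleftrightarrow> birack X \<sigma> \<and> (\<forall>x \<in> X. \<exists>!y. y \<in> X \<and> \<sigma> (x, y) = (x, y))"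

text \<open>
  \<open>dot_op X \<sigma> x\<close> is the map \<open>x \<cdot> (-)\<close>, the inverse of the bijection \<open>x * (-) = g\<^sub>x\<close> of \<open>X\<close>,
  and \<open>rack_op X \<sigma> x y\<close> is \<open>x \<triangleleft> y\<close>.
\<close>

definition dot_op :: "'a set \<Rightarrow> ('a \<times> 'a \<Rightarrow> 'a \<times> 'a) \<Rightarrow> 'a \<Rightarrow> 'a \<Rightarrow> 'a" where
  "dot_op X \<sigma> x = inv_into X (g_map \<sigma> x)"

definition rack_op :: "'a set \<Rightarrow> ('a \<times> 'a \<Rightarrow> 'a \<times> 'a) \<Rightarrow> 'a \<Rightarrow> 'a \<Rightarrow> 'a" where
  "rack_op X \<sigma> x y = g_map \<sigma> y (f_map \<sigma> (dot_op X \<sigma> x y) x)"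

definition linear_automorphism ::
    "'a set \<Rightarrow> ('a \<times> 'a \<Rightarrow> 'a \<times> 'a) \<Rightarrow> ('a \<Rightarrow> 'a) \<Rightarrow> bool" where
  "linear_automorphism X \<sigma> \<phi> \<longleftrightarrow>
     bij_betw \<phi> X X \<and>
     (\<forall>x \<in> X. \<forall>y \<in> X.
        \<phi> (dot_op X \<sigma> x y) = dot_op X \<sigma> x (\<phi> y) \<and>
        dot_op X \<sigma> (\<phi> x) y = dot_op X \<sigma> x y \<and>
        \<phi> (rack_op X \<sigma> x y) = rack_op X \<sigma> (\<phi> x) y \<and>
        rack_op X \<sigma> x (\<phi> y) = rack_op X \<sigma> x y)"

text \<open>The two twists of the second kind, \<open>\<sigma>(\<phi> \<times> Id)\<close> and \<open>\<sigma>(Id \<times> \<phi>)\<close>.\<close>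

definition left_twist :: "('a \<Rightarrow> 'a) \<Rightarrow> ('a \<times> 'a \<Rightarrow> 'a \<times> 'a) \<Rightarrow> 'a \<times> 'a \<Rightarrow> 'a \<times> 'a" where
  "left_twist \<phi> \<sigma> = \<sigma> \<circ> map_prod \<phi> id"

definition right_twist :: "('a \<times> 'a \<Rightarrow> 'a \<times> 'a) \<Rightarrow> ('a \<Rightarrow> 'a) \<Rightarrow> 'a \<times> 'a \<Rightarrow> 'a \<times> 'a" where
  "right_twist \<sigma> \<phi> = \<sigma> \<circ> map_prod id \<phi>"

end

theory Submission
  imports Defs
begin

text \<open>
  In a birack the pairs fixed by \<open>\<sigma>\<close> correspond to the elements with \<open>x \<triangleleft> x = x\<close>, so the
  obstruction to being a biquandle is the squaring map \<open>\<pi> x = x \<triangleleft> x\<close> of the derived rack. This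
  map is a linear automorphism: every \<open>g\<^sub>x\<close> is a rack automorphism, hence commutes with \<open>\<pi>\<close>, and
  the invariance \<open>g\<^bsub>\<pi> y\<^esub> = g\<^sub>y\<close> follows from the braid equation because every \<open>y\<close> has the form
  \<open>x \<cdot> x\<close>. Twisting by \<open>\<pi>\<inverse>\<close> replaces \<open>\<triangleleft>\<close> by \<open>\<pi>\<inverse> (x \<triangleleft> y)\<close>, which is idempotent.
\<close>

lemma braid_equation_iff:
  "braid_equation X \<sigma> \<longleftrightarrow> (\<forall>x\<in>X. \<forall>y\<in>X. \<forall>z\<in>X.
     g_map \<sigma> (g_map \<sigma> x y) (g_map \<sigma> (f_map \<sigma> y x) z) = g_map \<sigma> x (g_map \<sigma> y z) \<and>
     f_map \<sigma> (g_map \<sigma> (f_map \<sigma> y x) z) (g_map \<sigma> x y) =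
       g_map \<sigma> (f_map \<sigma> (g_map \<sigma> y z) x) (f_map \<sigma> z y) \<and>
     f_map \<sigma> z (f_map \<sigma> y x) = f_map \<sigma> (f_map \<sigma> z y) (f_map \<sigma> (g_map \<sigma> y z) x))"
  by (simp add: braid_equation_def act12_def act23_def g_map_def f_map_def prod_eq_iff case_prod_unfold)

lemma map_eq_g_f: "\<sigma> (x, y) = (g_map \<sigma> x y, f_map \<sigma> y x)"
  by (simp add: g_map_def f_map_def)

section \<open>The component operations of a birack\<close>

locale birack_on =
  fixes X :: "'a set" and \<sigma> :: "'a \<times> 'a \<Rightarrow> 'a \<times> 'a"
  assumes birack: "birack X \<sigma>"
begin

abbreviation g where "g \<equiv> g_map \<sigma>"
abbreviation f where "f \<equiv> f_map \<sigma>"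
abbreviation dot (infixl "\<cdot>" 70) where "x \<cdot> y \<equiv> dot_op X \<sigma> x y"
abbreviation rack (infixl "\<triangleleft>" 65) where "x \<triangleleft> y \<equiv> rack_op X \<sigma> x y"

lemma bij_g: "x \<in> X \<Longrightarrow> bij_betw (g x) X X"
  and bij_f: "y \<in> X \<Longrightarrow> bij_betw (f y) X X"
  and bij_map: "bij_betw \<sigma> (X \<times> X) (X \<times> X)"
  using birack by (simp_all add: birack_def)

lemma g_closed [simp]: "x \<in> X \<Longrightarrow> y \<in> X \<Longrightarrow> g x y \<in> X"
  and f_closed [simp]: "x \<in> X \<Longrightarrow> y \<in> X \<Longrightarrow> f y x \<in> X"
  using bij_betwE[OF bij_g] bij_betwE[OF bij_f] by simp_all

lemma dot_closed [simp]: "x \<in> X \<Longrightarrow> y \<in> X \<Longrightarrow> x \<cdot> y \<in> X"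
  and g_dot [simp]: "x \<in> X \<Longrightarrow> y \<in> X \<Longrightarrow> g x (x \<cdot> y) = y"
  and dot_g [simp]: "x \<in> X \<Longrightarrow> y \<in> X \<Longrightarrow> x \<cdot> g x y = y"
  unfolding dot_op_def
  using bij_betwE[OF bij_betw_inv_into[OF bij_g]]
    bij_betw_inv_into_right[OF bij_g] bij_betw_inv_into_left[OF bij_g]
  by simp_all

lemma g_inject: "x \<in> X \<Longrightarrow> y \<in> X \<Longrightarrow> z \<in> X \<Longrightarrow> g x y = g x z \<longleftrightarrow> y = z"
  by (metis dot_g)

lemma rack_closed [simp]: "x \<in> X \<Longrightarrow> y \<in> X \<Longrightarrow> x \<triangleleft> y \<in> X"
  by (simp add: rack_op_def)

lemma braid_g:
  "x \<in> X \<Longrightarrow> y \<in> X \<Longrightarrow> z \<in> X \<Longrightarrow> g (g x y) (g (f y x) z) = g x (g y z)"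
  and braid_mid:
  "x \<in> X \<Longrightarrow> y \<in> X \<Longrightarrow> z \<in> X \<Longrightarrow> f (g (f y x) z) (g x y) = g (f (g y z) x) (f z y)"
  and braid_f:
  "x \<in> X \<Longrightarrow> y \<in> X \<Longrightarrow> z \<in> X \<Longrightarrow> f z (f y x) = f (f z y) (f (g y z) x)"
  using birack unfolding birack_def braid_equation_iff by blast+

section \<open>The derived rack\<close>

lemma g_f: "x \<in> X \<Longrightarrow> y \<in> X \<Longrightarrow> g (g x y) (f y x) = x \<triangleleft> g x y"
  by (simp add: rack_op_def)

text \<open>Recovers \<open>f\<close> from \<cdot> and \<triangleleft>, so what is known about these
  two operations transfers to \<open>f\<close>.\<close>

lemma f_eq: "x \<in> X \<Longrightarrow> y \<in> X \<Longrightarrow> f y x = g x y \<cdot> (x \<triangleleft> g x y)"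
  by (metis g_f dot_g f_closed g_closed)

text \<open>Apply \<open>g (g a c)\<close> to the middle component of the braid equation:
  \<open>g_f\<close> turns the left side into a derived product, and the first component moves
  \<open>g a\<close> to the front on the right.\<close>

lemma g_rack:
  assumes "a \<in> X" "b \<in> X" "c \<in> X"
  shows "g a (b \<triangleleft> c) = g a b \<triangleleft> g a c"
proof -
  \<comment> \<open>Chosen so that \<open>b \<triangleleft> c\<close> is \<open>g c (f w b)\<close>
    and the braid equation applies to \<open>(a, b, w)\<close>.\<close>
  define w where "w = b \<cdot> c"
  have w: "w \<in> X" "g b w = c" using assms by (auto simp: w_def)
  have eq: "g (g a b) (g (f b a) w) = g a c" using braid_g[of a b w] assms w by simp
  have "g a b \<triangleleft> g a c = g (g a c) (f (g (f b a) w) (g a b))"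
    using g_f[of "g a b" "g (f b a) w"] assms w eq by simp
  also have "\<dots> = g (g a c) (g (f c a) (f w b))"
    using braid_mid[of a b w] assms w by simp
  also have "\<dots> = g a (g c (f w b))" using braid_g[of a c "f w b"] assms w by simp
  also have "\<dots> = g a (b \<triangleleft> c)" using g_f[of b w] assms w by simp
  finally show ?thesis by simp
qed

text \<open>Let \<open>(p, q, r)\<close> be the common value of both sides of the braid equation at
  \<open>(x, y, z)\<close>. Computing \<open>g p (g q r)\<close> through one side gives the left
  product, through the other side the right one.\<close>

lemma rack_distrib:
  assumes "x \<in> X" "u \<in> X" "v \<in> X"
  shows "(x \<triangleleft> u) \<triangleleft> v = (x \<triangleleft> v) \<triangleleft> (u \<triangleleft> v)"
proof -
  \<comment> \<open>\<open>y\<close> and \<open>z\<close> make \<open>g x y\<close> equal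
    \<open>u\<close> and the first output equal \<open>v\<close>; the second output is then
    \<open>f w u\<close>.\<close>
  define y where "y = x \<cdot> u"
  define z where "z = y \<cdot> (x \<cdot> v)"
  define w where "w = g (f y x) z"
  have y: "y \<in> X" "g x y = u" and z: "z \<in> X" "g x (g y z) = v"
    using assms by (auto simp: y_def z_def)
  have w: "w \<in> X" "g u w = v"
    using braid_g[of x y z] assms y z by (auto simp: w_def)
  have mid: "f w u = g (f (g y z) x) (f z y)"
    using braid_mid[of x y z] assms y z by (simp add: w_def)
  have "(x \<triangleleft> u) \<triangleleft> v = g u (f y x \<triangleleft> w)"
    using g_f[of x y] g_rack[of u "f y x" w] assms y w by simp
  also have "\<dots> = g u (g w (f z (f y x)))"
    using g_f[of "f y x" z] assms y z by (simp add: w_def)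
  also have "\<dots> = g v (g (f w u) (f z (f y x)))"
    using braid_g[of u w "f z (f y x)"] assms y z w by simp
  also have "\<dots> = g v (g (f w u) (f (f z y) (f (g y z) x)))"
    using braid_f[of x y z] assms y z by simp
  also have "\<dots> = g v (f (g y z) x \<triangleleft> f w u)"
    using g_f[of "f (g y z) x" "f z y"] assms y z mid by simp
  also have "\<dots> = g v (f (g y z) x) \<triangleleft> g v (f w u)"
    using g_rack[of v "f (g y z) x" "f w u"] assms y z w by simp
  also have "\<dots> = (x \<triangleleft> v) \<triangleleft> (u \<triangleleft> v)"
    using g_f[of x "g y z"] g_f[of u w] assms y z w by simp
  finally show ?thesis .
qed

lemma rack_inject:
  assumes "x \<in> X" "x' \<in> X" "u \<in> X" "x \<triangleleft> u = x' \<triangleleft> u"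
  shows "x = x'"
proof -
  \<comment> \<open>Both sides equal \<open>(u, u \<cdot> (x \<triangleleft> u))\<close>, so
    injectivity of \<sigma> gives that of right translation by \<open>u\<close>.\<close>
  have "\<sigma> (x, x \<cdot> u) = \<sigma> (x', x' \<cdot> u)"
    using assms by (simp add: map_eq_g_f f_eq)
  with bij_map assms show ?thesis
    by (auto simp: bij_betw_def dest: inj_onD)
qed

lemma rack_surj:
  assumes "t \<in> X" "u \<in> X"
  obtains x where "x \<in> X" "x \<triangleleft> u = t"
proof -
  have "(u, u \<cdot> t) \<in> \<sigma> ` (X \<times> X)"
    using bij_map assms by (simp add: bij_betw_imp_surj_on)
  then obtain x y where xy: "x \<in> X" "y \<in> X" "u = g x y" "u \<cdot> t = f y x"
    by (auto simp: map_eq_g_f)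
  then have "x \<triangleleft> u = t" using g_f[of x y] assms by (metis g_dot)
  with xy that show thesis by blast
qed

section \<open>The squaring map\<close>

definition sq :: "'a \<Rightarrow> 'a" where "sq x = x \<triangleleft> x"

lemma sq_closed [simp]: "x \<in> X \<Longrightarrow> sq x \<in> X"
  by (simp add: sq_def)

text \<open>Write \<open>x\<close> as \<open>z \<triangleleft> y\<close>; then the claim is
  self-distributivity for \<open>z, y, y\<close>.\<close>

lemma rack_sq:
  assumes "x \<in> X" "y \<in> X"
  shows "x \<triangleleft> sq y = x \<triangleleft> y"
proof -
  obtain z where "z \<in> X" "z \<triangleleft> y = x" using rack_surj assms by blast
  then show ?thesis using rack_distrib[of z y y] assms by (metis sq_def)
qed

lemma sq_rack: "x \<in> X \<Longrightarrow> y \<in> X \<Longrightarrow> sq x \<triangleleft> y = sq (x \<triangleleft> y)"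
  by (simp add: sq_def rack_distrib[of x x y])

lemma bij_sq: "bij_betw sq X X"
  unfolding bij_betw_def
proof
  show "inj_on sq X"
  proof
    fix x y assume xy: "x \<in> X" "y \<in> X" "sq x = sq y"
    \<comment> \<open>As \<open>sq y = sq x\<close>, this reads
      \<open>y \<triangleleft> x = x \<triangleleft> x\<close>, and right translation by
      \<open>x\<close> cancels.\<close>
    then have "y \<triangleleft> x = y \<triangleleft> y" using rack_sq by metis
    with xy show "x = y" using rack_inject by (metis sq_def)
  qed
  have "t \<in> sq ` X" if t: "t \<in> X" for t
  proof -
    \<comment> \<open>This \<open>x\<close> is the square root of \<open>t\<close>: both
      \<open>x \<triangleleft> x\<close> and \<open>x \<triangleleft> t\<close> are sent to
      \<open>t \<triangleleft> t\<close> by right translation by \<open>t\<close>.\<close>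
    obtain x where x: "x \<in> X" "x \<triangleleft> t = t" using rack_surj t by blast
    then have "(x \<triangleleft> x) \<triangleleft> t = (x \<triangleleft> t) \<triangleleft> t"
      using rack_distrib t by metis
    then have "x \<triangleleft> x = x \<triangleleft> t" using rack_inject x t by (metis rack_closed)
    with x show ?thesis by (metis sq_def image_eqI)
  qed
  then show "sq ` X = X" by auto
qed

lemma g_sq_commute: "x \<in> X \<Longrightarrow> y \<in> X \<Longrightarrow> g x (sq y) = sq (g x y)"
  by (simp add: sq_def g_rack)

lemma dot_self_surj:
  assumes "y \<in> X"
  obtains u where "u \<in> X" "u \<cdot> u = y"
proof -
  obtain x where x: "x \<in> X" "f y x = y"
    using bij_f[OF assms] assms by (metis bij_betw_def imageE)
  define u where "u = g x y"
  have u: "u \<in> X" using x assms by (simp add: u_def)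
  \<comment> \<open>With \<open>f y x = y\<close>, the factor \<open>g y\<close> cancels on the
    right of \<open>g u \<circ> g y = g x \<circ> g y\<close>.\<close>
  have "g x z = g u z" if "z \<in> X" for z
    using braid_g[of x y "y \<cdot> z"] x assms that by (simp add: u_def)
  from this[OF assms] have "g u y = u" by (simp only: u_def)
  with that u show thesis using assms by (metis dot_g)
qed

text \<open>For \<open>y = x \<cdot> x\<close> one has \<open>\<sigma> (x, y) = (x, sq y)\<close>,
  so the first braid component becomes an identity between \<open>g (sq y)\<close> and
  \<open>g y\<close> from which \<open>g x\<close> cancels.\<close>

lemma g_sq:
  assumes "y \<in> X" "z \<in> X"
  shows "g (sq y) z = g y z"
proof -
  obtain x where x: "x \<in> X" "x \<cdot> x = y" using dot_self_surj assms by blast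
  then have gxy: "g x y = x" by (metis g_dot)
  have "f y x = x \<cdot> sq x" using f_eq[of x y] x assms gxy by (simp add: sq_def)
  moreover have "g x (sq y) = sq x" using g_sq_commute x assms gxy by simp
  ultimately have "f y x = sq y" using x assms by (metis dot_g sq_closed)
  then have "g x (g (sq y) z) = g x (g y z)"
    using braid_g[of x y z] x assms gxy by simp
  then show ?thesis using g_inject x assms by simp
qed

section \<open>The inverse of the squaring map\<close>

definition sqrt :: "'a \<Rightarrow> 'a" where "sqrt = inv_into X sq"

lemma bij_sqrt: "bij_betw sqrt X X"
  unfolding sqrt_def by (rule bij_betw_inv_into[OF bij_sq])

lemma sqrt_closed [simp]: "x \<in> X \<Longrightarrow> sqrt x \<in> X"
  using bij_betwE[OF bij_sqrt] by simp

lemma sq_sqrt [simp]: "x \<in> X \<Longrightarrow> sq (sqrt x) = x"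
  and sqrt_sq [simp]: "x \<in> X \<Longrightarrow> sqrt (sq x) = x"
  unfolding sqrt_def using bij_sq
  by (simp_all add: bij_betw_inv_into_right bij_betw_inv_into_left)

lemma g_sqrt: "x \<in> X \<Longrightarrow> y \<in> X \<Longrightarrow> g (sqrt x) y = g x y"
  using g_sq[of "sqrt x" y] by simp

lemma g_sqrt_commute: "x \<in> X \<Longrightarrow> y \<in> X \<Longrightarrow> g x (sqrt y) = sqrt (g x y)"
  using g_sq_commute[of x "sqrt y"] by (metis g_closed sq_sqrt sqrt_closed sqrt_sq)

lemma sqrt_rack: "x \<in> X \<Longrightarrow> y \<in> X \<Longrightarrow> sqrt x \<triangleleft> y = sqrt (x \<triangleleft> y)"
  using sq_rack[of "sqrt x" y] by (metis rack_closed sq_sqrt sqrt_closed sqrt_sq)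

lemma rack_sqrt: "x \<in> X \<Longrightarrow> y \<in> X \<Longrightarrow> x \<triangleleft> sqrt y = x \<triangleleft> y"
  using rack_sq[of x "sqrt y"] by simp

lemma dot_sq_commute: "x \<in> X \<Longrightarrow> y \<in> X \<Longrightarrow> x \<cdot> sq y = sq (x \<cdot> y)"
  by (metis dot_closed dot_g g_dot g_sq_commute sq_closed)

lemma dot_sqrt_commute: "x \<in> X \<Longrightarrow> y \<in> X \<Longrightarrow> x \<cdot> sqrt y = sqrt (x \<cdot> y)"
  by (metis dot_closed dot_g g_dot g_sqrt_commute sqrt_closed)

lemma sq_dot: "x \<in> X \<Longrightarrow> y \<in> X \<Longrightarrow> sq x \<cdot> y = x \<cdot> y"
  by (metis dot_closed dot_g g_dot g_sq sq_closed)

lemma sqrt_dot: "x \<in> X \<Longrightarrow> y \<in> X \<Longrightarrow> sqrt x \<cdot> y = x \<cdot> y"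
  using sq_dot[of "sqrt x" y] by simp

text \<open>In the formula \<open>f_eq\<close>, \<open>y\<close> enters only through
  \<open>g x y\<close>, as the left argument of \<cdot> and the right argument of \<triangleleft>;
  both ignore \<open>sqrt\<close>.\<close>

lemma f_sqrt:
  assumes "x \<in> X" "y \<in> X"
  shows "f (sqrt y) x = f y x"
  using assms by (simp add: f_eq g_sqrt_commute rack_sqrt sqrt_dot)

lemma f_sqrt_commute: "x \<in> X \<Longrightarrow> y \<in> X \<Longrightarrow> f y (sqrt x) = sqrt (f y x)"
  by (simp add: f_eq g_sqrt sqrt_rack dot_sqrt_commute)

section \<open>The twisted birack\<close>

abbreviation \<tau> where "\<tau> \<equiv> left_twist sqrt \<sigma>"

lemma g_twist: "x \<in> X \<Longrightarrow> y \<in> X \<Longrightarrow> g_map \<tau> x y = g x y"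
  using g_sqrt by (simp add: left_twist_def g_map_def)

lemma f_twist: "f_map \<tau> y x = f y (sqrt x)"
  by (simp add: left_twist_def f_map_def)

lemma dot_twist:
  assumes "x \<in> X" "y \<in> X"
  shows "dot_op X \<tau> x y = x \<cdot> y"
proof -
  have "inv_into X (g_map \<tau> x) (g_map \<tau> x (x \<cdot> y)) = x \<cdot> y"
  proof (rule inv_into_f_f)
    show "inj_on (g_map \<tau> x) X"
      using assms g_inject by (simp add: inj_on_def g_twist)
  qed (use assms in simp)
  then show ?thesis using assms by (simp add: dot_op_def[of X \<tau>] g_twist)
qed

lemma rack_twist: "x \<in> X \<Longrightarrow> y \<in> X \<Longrightarrow> rack_op X \<tau> x y = sqrt (x \<triangleleft> y)"
  by (simp add: rack_op_def[of X \<tau>] dot_twist f_twist g_twist sqrt_rack f_sqrt_commute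
      g_sqrt_commute) (simp add: rack_op_def)

lemma birack_twist: "birack X \<tau>"
  unfolding birack_def
proof (intro conjI ballI)
  have "bij_betw (map_prod sqrt id) (X \<times> X) (X \<times> X)"
    using bij_sqrt by (intro bij_betw_map_prod) auto
  then show "bij_betw \<tau> (X \<times> X) (X \<times> X)"
    unfolding left_twist_def using bij_map by (rule bij_betw_trans)
  show "bij_betw (g_map \<tau> x) X X" if "x \<in> X" for x
    using bij_g[OF that] bij_betw_cong[of X "g_map \<tau> x" "g x"] g_twist that by simp
  show "bij_betw (f_map \<tau> y) X X" if "y \<in> X" for y
  proof -
    have "f_map \<tau> y = f y \<circ> sqrt" by (simp add: fun_eq_iff f_twist)
    then show ?thesis using bij_betw_trans[OF bij_sqrt bij_f[OF that]] by simp
  qed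
  show "braid_equation X \<tau>"
    unfolding braid_equation_iff
  proof (intro ballI)
    fix x y z assume "x \<in> X" "y \<in> X" "z \<in> X"
    with braid_g[of x y z] braid_mid[of x y z] braid_f[of x y z]
    show "g_map \<tau> (g_map \<tau> x y) (g_map \<tau> (f_map \<tau> y x) z) = g_map \<tau> x (g_map \<tau> y z) \<and>
      f_map \<tau> (g_map \<tau> (f_map \<tau> y x) z) (g_map \<tau> x y) =
        g_map \<tau> (f_map \<tau> (g_map \<tau> y z) x) (f_map \<tau> z y) \<and>
      f_map \<tau> z (f_map \<tau> y x) = f_map \<tau> (f_map \<tau> z y) (f_map \<tau> (g_map \<tau> y z) x)"
      \<comment> \<open>All occurrences of \<open>sqrt\<close> move outward or vanish, leaving none,
        one and two of them on both sides of the three components respectively.\<close>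
      by (simp add: g_twist f_twist f_sqrt f_sqrt_commute g_sqrt g_sqrt_commute)
  qed
qed

lemma biquandle_twist: "biquandle X \<tau>"
  unfolding biquandle_def
proof (intro conjI ballI birack_twist)
  fix x assume x: "x \<in> X"
  have \<tau>_eq: "\<tau> (x, y) = (g x y, sqrt (f y x))" if "y \<in> X" for y
    using x that by (simp add: map_eq_g_f[of \<tau>] g_twist f_twist f_sqrt_commute)
  show "\<exists>!y. y \<in> X \<and> \<tau> (x, y) = (x, y)"
  proof
    \<comment> \<open>The first coordinate forces \<open>y = x \<cdot> x\<close>; there the second
      coordinate of \<sigma> is off by exactly one \<open>sq\<close>, which the \<open>sqrt\<close>
      in \<tau> removes.\<close>
    have "f (x \<cdot> x) x = sq (x \<cdot> x)"
      using f_eq[of x "x \<cdot> x"] x by (simp add: dot_sq_commute flip: sq_def)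
    then show "x \<cdot> x \<in> X \<and> \<tau> (x, x \<cdot> x) = (x, x \<cdot> x)"
      using x by (simp add: \<tau>_eq)
    show "y = x \<cdot> x" if "y \<in> X \<and> \<tau> (x, y) = (x, y)" for y
      using that x \<tau>_eq by (metis dot_g prod.inject)
  qed
qed

lemma linear_automorphism_twist: "linear_automorphism X \<tau> sq"
  unfolding linear_automorphism_def
  by (simp add: bij_sq dot_twist rack_twist dot_sq_commute sq_dot sq_rack rack_sq)

lemma left_twist_sq_twist: "p \<in> X \<times> X \<Longrightarrow> left_twist sq \<tau> p = \<sigma> p"
  by (auto simp: left_twist_def)

end

theorem corollary3p15:
  fixes X :: "'a set" and \<sigma> :: "'a \<times> 'a \<Rightarrow> 'a \<times> 'a"
  assumes "finite X" and "birack X \<sigma>"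
  shows "\<exists>\<tau> \<psi>. biquandle X \<tau> \<and> linear_automorphism X \<tau> \<psi> \<and>
           ((\<forall>p \<in> X \<times> X. \<sigma> p = left_twist \<psi> \<tau> p) \<or>
            (\<forall>p \<in> X \<times> X. \<sigma> p = right_twist \<tau> \<psi> p))"
proof -
  interpret birack_on X \<sigma> by standard (fact assms(2))
  show ?thesis
    using biquandle_twist linear_automorphism_twist left_twist_sq_twist
    \<comment> \<open>Since \<open>sqrt\<close> undoes \<open>sq\<close> on \<open>X\<close>,
      twisting \<tau> on the left by \<open>sq\<close> returns \<sigma>.\<close>
    by (intro exI[of _ \<tau>] exI[of _ sq]) simp
qed

end
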